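(* Let $d\ge 1$ be an integer, let $N$ be the number of sample points, let $V>0$ be the volume of the sampling domain $\mathcal{D}$, and let $r_{\min}>0$ be the desired coverage radius. The $d$-dimensional space-filling spectral (Step PCF) design with $N$ sample points in $\mathcal{D}$ and coverage radius $r_{\min}$, i.e. the design whose pair correlation function is $$G(r)=\begin{cases}0 & \text{if } r<r_{\min},\\ 1 & \text{if } r\ge r_{\min},\end{cases}$$ has power spectral density $$P(k)=1-\frac{N}{V}\left(\frac{2\pi r_{\min}}{k}\right)^{\frac d2}J_{\frac d2}(k r_{\min}),\qquad k>0,$$ where $J_{d/2}$ is the Bessel function (of the first kind) of order $d/2$.
   Context: For an isotropic sample design of $N$ points in a $d$-dimensional sampling domain of volume $V$, with pair correlation function (PCF) $G(\mathbf r)=G(r)$, $r=\|\mathbf r\|$, the power spectral density (PSD) is the radial function $P(k)=P(\mathbf k)$, $k=\|\mathbf k\|$, given by $$P(\mathbf k)=1+\frac{N}{V}\int_{\mathbb{R}^d}\bigl(G(\mathbf r)-1\bigr)\exp(-i\,\mathbf k\cdot\mathbf r)\,d\mathbf r .$$ A space-filling spectral design (Step PCF design) with coverage radius $r_{\min}$ is defined by its PCF being the step function written in the claim. *)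

theory Defs
  imports "HOL-Analysis.Analysis"
begin

text \<open>
  The Bessel function of the first kind, by its power series. The principal power
  \<open>(x / 2) powr \<nu>\<close> makes this the usual function for \<open>x > 0\<close>; \<open>x \<le> 0\<close> is not intended.
  \<open>rGamma\<close> is the entire function \<open>1 / Gamma\<close>, so no order \<open>\<nu>\<close> is exceptional.
\<close>
definition Bessel_J :: "real \<Rightarrow> real \<Rightarrow> real" where
  "Bessel_J \<nu> x =
     (x / 2) powr \<nu> * (\<Sum>m. (- 1) ^ m * rGamma (real m + \<nu> + 1) / fact m * (x / 2) ^ (2 * m))"

text \<open>
  The pair correlation function \<open>G\<close> is radial and given as a function of the distance;
  the wave vector \<open>k\<close> is kept as a vector.
\<close>
definition psd :: "nat \<Rightarrow> real \<Rightarrow> (real \<Rightarrow> real) \<Rightarrow> real ^ 'd \<Rightarrow> complex" where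
  "psd N V G k =
     1 + complex_of_real (real N / V) *
       (LINT r|lebesgue. complex_of_real (G (norm r) - 1) * exp (- \<i> * complex_of_real (k \<bullet> r)))"

definition step_pcf :: "real \<Rightarrow> real \<Rightarrow> real" where
  "step_pcf r_min r = (if r < r_min then 0 else 1)"

end

theory Submission
  imports Defs "HOL-Probability.Distributions" "HOL-Complex_Analysis.Cauchy_Integral_Formula"
begin

text \<open>
  Expanding \<open>cos (u \<bullet> x)\<close> in its power series reduces the Fourier transform of a ball to the moments
  of \<open>(u \<bullet> x) ^ (2 * m)\<close> over the unit ball. By homogeneity and
  \<open>exp (- (norm x)\<^sup>2) = \<integral> exp (- t) dt\<close> over \<open>t > (norm x)\<^sup>2\<close>, the moment of order \<open>2 * m\<close> of the
  Gaussian is \<open>Gamma (m + d / 2 + 1)\<close> times that of the ball. The Gaussian moments are the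
  coefficients of the integral of \<open>cosh (s * (u \<bullet> x)) * exp (- (norm x)\<^sup>2)\<close>, which factors over
  the coordinates into one-dimensional Gaussian integrals.
\<close>

section \<open>Gaussian integrals with a linear term in the exponent\<close>

lemma nn_integral_gaussian_linear_real:
  "(\<integral>\<^sup>+t. ennreal (exp (a * t - t\<^sup>2)) \<partial>lborel) = ennreal (sqrt pi * exp (a\<^sup>2 / 4))"
proof -
  \<comment> \<open>Completing the square: a t - t^2 = a^2/4 - (t - a/2)^2. A normal density of
    variance 1/2 has normalising constant 1 / sqrt pi.\<close>
  have eq: "exp (a * t - t\<^sup>2) = sqrt pi * exp (a\<^sup>2 / 4) * normal_density (a / 2) (sqrt (1 / 2)) t" for t
    by (simp add: normal_density_def exp_add [symmetric] exp_minus [symmetric] power2_eq_square algebra_simps flip: exp_diff)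
  have "(\<integral>\<^sup>+t. ennreal (normal_density (a / 2) (sqrt (1 / 2)) t) \<partial>lborel) = 1"
    by (subst nn_integral_eq_integral) auto
  then show ?thesis
    unfolding eq by (simp add: ennreal_mult' nn_integral_cmult)
qed

lemma nn_integral_gaussian_linear:
  fixes v :: "'a::euclidean_space"
  shows "(\<integral>\<^sup>+x. ennreal (exp (v \<bullet> x - (norm x)\<^sup>2)) \<partial>lborel)
    = ennreal (pi powr (real DIM('a) / 2) * exp ((norm v)\<^sup>2 / 4))"
proof -
  have norm_sq: "(norm x)\<^sup>2 = (\<Sum>b\<in>Basis. (x \<bullet> b)\<^sup>2)" for x :: 'a
    unfolding power2_norm_eq_inner by (subst euclidean_inner) (simp add: power2_eq_square)
  have "exp (v \<bullet> x - (norm x)\<^sup>2) = (\<Prod>b\<in>Basis. exp ((v \<bullet> b) * (x \<bullet> b) - (x \<bullet> b)\<^sup>2))" for x :: 'a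
    by (simp add: norm_sq euclidean_inner [of v x] exp_sum [symmetric] sum_subtractf)
  then have "(\<integral>\<^sup>+x. ennreal (exp (v \<bullet> x - (norm x)\<^sup>2)) \<partial>lborel)
    = (\<Prod>b\<in>Basis. ennreal (sqrt pi * exp ((v \<bullet> b)\<^sup>2 / 4)))"
    using nn_integral_lborel_prod [of "\<lambda>b t. ennreal (exp ((v \<bullet> b) * t - t\<^sup>2))"]
    by (simp add: nn_integral_gaussian_linear_real flip: prod_ennreal)
  also have "\<dots> = ennreal (sqrt pi ^ DIM('a) * exp ((norm v)\<^sup>2 / 4))"
    by (simp add: prod_ennreal prod.distrib norm_sq exp_sum sum_divide_distrib)
  also have "sqrt pi ^ DIM('a) = pi powr (real DIM('a) / 2)"
    by (simp add: powr_half_sqrt [symmetric] powr_powr flip: powr_realpow)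
  finally show ?thesis .
qed

section \<open>Homogeneous functions integrated over balls and against the Gaussian\<close>

lemma nn_integral_homogeneous_ball:
  fixes f :: "'a::euclidean_space \<Rightarrow> ennreal"
  assumes [measurable]: "f \<in> borel_measurable borel"
    and hom: "\<And>c x. c > 0 \<Longrightarrow> f (c *\<^sub>R x) = ennreal (c ^ n) * f x"
    and r: "r > 0"
  shows "(\<integral>\<^sup>+x\<in>ball 0 r. f x \<partial>lborel) = ennreal (r ^ (DIM('a) + n)) * (\<integral>\<^sup>+x\<in>ball 0 1. f x \<partial>lborel)"
proof -
  have [measurable]: "ball (0 :: 'a) r \<in> sets borel" "ball (0 :: 'a) 1 \<in> sets borel"
    by simp_all
  have ind: "indicator (ball 0 r) (r *\<^sub>R x) = (indicator (ball 0 1) x :: ennreal)" for x :: 'a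
    using r by (auto simp: indicator_def)
  have "(\<integral>\<^sup>+x\<in>ball 0 r. f x \<partial>lborel)
    = (\<integral>\<^sup>+x. f x * indicator (ball 0 r) x \<partial>density (distr lborel borel (\<lambda>x. 0 + r *\<^sub>R x)) (\<lambda>_. ennreal (\<bar>r\<bar> ^ DIM('a))))"
    \<comment> \<open>The substitution x -> r x has Jacobian \<open>r ^ DIM('a)\<close>; homogeneity
      then contributes the further factor \<open>r ^ n\<close>.\<close>
    using r by (subst lborel_affine [of r 0]) auto
  also have "\<dots> = (\<integral>\<^sup>+x. ennreal (\<bar>r\<bar> ^ DIM('a)) * (f x * indicator (ball 0 r) x)
      \<partial>distr lborel borel (\<lambda>x. 0 + r *\<^sub>R x))"
    by (rule nn_integral_density) measurable
  also have "\<dots> = (\<integral>\<^sup>+x. ennreal (\<bar>r\<bar> ^ DIM('a)) * (f (0 + r *\<^sub>R x) * indicator (ball 0 r) (0 + r *\<^sub>R x)) \<partial>lborel)"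
    by (rule nn_integral_distr) measurable
  also have "\<dots> = (\<integral>\<^sup>+x. ennreal (r ^ DIM('a)) * (ennreal (r ^ n) * (f x * indicator (ball 0 1) x)) \<partial>lborel)"
    using r by (simp add: hom ind mult_ac)
  also have "\<dots> = ennreal (r ^ DIM('a)) * (ennreal (r ^ n) * (\<integral>\<^sup>+x\<in>ball 0 1. f x \<partial>lborel))"
    by (simp add: nn_integral_cmult)
  also have "\<dots> = ennreal (r ^ (DIM('a) + n)) * (\<integral>\<^sup>+x\<in>ball 0 1. f x \<partial>lborel)"
    using r by (simp add: power_add ennreal_mult' mult_ac)
  finally show ?thesis .
qed

text \<open>Tonelli turns the Gaussian weight into a mixture of balls of radius sqrt t with weight
  exp (-t). Scaling each ball to the unit ball leaves a power of t, whose integral against exp (-t)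
  is a Gamma value. Working in \<open>ennreal\<close> allows both sides to be infinite.\<close>

lemma nn_integral_homogeneous_gaussian:
  fixes f :: "'a::euclidean_space \<Rightarrow> ennreal"
  assumes [measurable]: "f \<in> borel_measurable borel"
    and hom: "\<And>c x. c > 0 \<Longrightarrow> f (c *\<^sub>R x) = ennreal (c ^ n) * f x"
  shows "(\<integral>\<^sup>+x. f x * ennreal (exp (- (norm x)\<^sup>2)) \<partial>lborel)
    = ennreal (Gamma (real (DIM('a) + n) / 2 + 1)) * (\<integral>\<^sup>+x\<in>ball 0 1. f x \<partial>lborel)"
proof -
  \<comment> \<open>The shift by 1 makes \<open>t powr (s - 1)\<close>, the power in Euler's
    integral for \<open>Gamma s\<close>, equal to the scaling factor
    \<open>sqrt t ^ (DIM('a) + n)\<close>.\<close>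
  define s where "s = real (DIM('a) + n) / 2 + 1"
  have s: "s > 0" by (simp add: s_def add_nonneg_pos)
  \<comment> \<open>The strict inequality makes the layers in x open balls; it differs from the
    half-line \<open>{a..}\<close> only in the null set {a}.\<close>
  have expi: "ennreal (exp (- a)) = (\<integral>\<^sup>+t. (if a < t then ennreal (exp (- t)) else 0) \<partial>lborel)" for a :: real
  proof -
    have "((\<lambda>t::real. - exp (- t)) \<longlongrightarrow> 0) at_top"
      by (rule tendsto_eq_intros filterlim_compose [OF exp_at_bot] filterlim_uminus_at_bot_at_top)+ simp
    then have "(\<integral>\<^sup>+t. ennreal (exp (- t)) * indicator {a..} t \<partial>lborel) = ennreal (0 - (- exp (- a)))"
      by (intro nn_integral_FTC_atLeast) (auto intro!: derivative_eq_intros)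
    moreover have "(\<integral>\<^sup>+t. ennreal (exp (- t)) * indicator {a..} t \<partial>lborel)
      = (\<integral>\<^sup>+t. (if a < t then ennreal (exp (- t)) else 0) \<partial>lborel)"
      by (rule nn_integral_cong_AE, rule AE_mp [OF AE_lborel_singleton [of a]]) (auto simp: indicator_def)
    ultimately show ?thesis by simp
  qed
  have meas: "(\<lambda>x. f x * indicator (ball 0 r) x) \<in> borel_measurable borel" for r
  proof -
    have [measurable]: "ball (0 :: 'a) r \<in> sets borel"
      by simp
    show ?thesis by measurable
  qed
  \<comment> \<open>For t < 0 the layer is empty; the conjunct on t supplies the
    \<open>indicator {0..} t\<close> that the Gamma integral carries.\<close>
  have sq_less: "(norm x)\<^sup>2 < t \<longleftrightarrow> 0 \<le> t \<and> norm x < sqrt t" for x :: 'a and t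
    using real_sqrt_less_iff [of "(norm x)\<^sup>2" t] order_le_less_trans [OF zero_le_power2 [of "norm x"], of t]
    by (auto simp del: real_sqrt_less_iff)
  have "(\<integral>\<^sup>+x. f x * ennreal (exp (- (norm x)\<^sup>2)) \<partial>lborel)
    = (\<integral>\<^sup>+x. \<integral>\<^sup>+t. f x * (if (norm x)\<^sup>2 < t then ennreal (exp (- t)) else 0) \<partial>lborel \<partial>lborel)"
    by (intro nn_integral_cong, subst nn_integral_cmult, measurable) (simp only: expi [symmetric])
  also have "\<dots> = (\<integral>\<^sup>+t. \<integral>\<^sup>+x. f x * (if (norm x)\<^sup>2 < t then ennreal (exp (- t)) else 0) \<partial>lborel \<partial>lborel)"
    by (rule lborel_pair.Fubini') measurable
  also have "\<dots> = (\<integral>\<^sup>+t. \<integral>\<^sup>+x. ennreal (exp (- t)) * indicator {0..} t * (f x * indicator (ball 0 (sqrt t)) x) \<partial>lborel \<partial>lborel)"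
    by (intro nn_integral_cong) (auto simp: sq_less indicator_def mult_ac)
  also have "\<dots> = (\<integral>\<^sup>+t. ennreal (exp (- t)) * indicator {0..} t * (\<integral>\<^sup>+x\<in>ball 0 (sqrt t). f x \<partial>lborel) \<partial>lborel)"
    by (intro nn_integral_cong nn_integral_cmult) (simp add: meas)
  also have "\<dots> = (\<integral>\<^sup>+t. ennreal (indicator {0..} t * t powr (s - 1) / exp t) * (\<integral>\<^sup>+x\<in>ball 0 1. f x \<partial>lborel) \<partial>lborel)"
  proof (intro nn_integral_cong_AE)
    \<comment> \<open>The scaling law asks for a positive radius sqrt t, so the null set {0} is set
      aside; for t < 0 both sides vanish.\<close>
    have "AE t in lborel. t \<noteq> (0::real)"
      by (rule AE_lborel_singleton)
    then show "AE t in lborel. ennreal (exp (- t)) * indicator {0..} t * (\<integral>\<^sup>+x\<in>ball 0 (sqrt t). f x \<partial>lborel)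
      = ennreal (indicator {0..} t * t powr (s - 1) / exp t) * (\<integral>\<^sup>+x\<in>ball 0 1. f x \<partial>lborel)"
    proof eventually_elim
      case (elim t)
      show ?case
      proof (cases "t > 0")
        case True
        have "sqrt t ^ (DIM('a) + n) = t powr (s - 1)"
          using True by (simp add: s_def powr_half_sqrt [symmetric] powr_powr flip: powr_realpow)
        with True show ?thesis
          by (subst nn_integral_homogeneous_ball [OF assms]) (simp_all add: exp_minus divide_inverse ennreal_mult' mult_ac)
      qed (use elim in auto)
    qed
  qed
  also have "\<dots> = ennreal (Gamma s) * (\<integral>\<^sup>+x\<in>ball 0 1. f x \<partial>lborel)"
    using s by (simp add: nn_integral_multc Gamma_conv_nn_integral_real)
  finally show ?thesis by (simp add: s_def)
qed

section \<open>Even moments of a linear form over a ball, by comparing power series\<close>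

lemma powser_sums_0_imp_coeff_0:
  fixes c :: "nat \<Rightarrow> real"
  assumes sums: "\<And>y. y \<ge> 0 \<Longrightarrow> (\<lambda>n. c n * y ^ n) sums 0"
  shows "c n = 0"
proof (cases "n = 0")
  case True
  then show ?thesis
    using sums [of 0] powser_sums_zero_iff [of c 0] by simp
next
  case False
  define f where "f = (\<lambda>y. \<Sum>n. c n * y ^ n)"
  \<comment> \<open>Convergence is given only for y >= 0, but isolation of zeros concerns a
    two-sided neighbourhood of 0. Convergence at the larger point |y| + 1 extends it to negative
    y.\<close>
  have f: "(\<lambda>n. c n * (y - 0) ^ n) sums f y" for y
  proof -
    have "summable (\<lambda>n. c n * (\<bar>y\<bar> + 1) ^ n)"
      using sums [of "\<bar>y\<bar> + 1"] by (simp add: sums_iff)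
    from powser_inside [OF this, of y] show ?thesis
      by (simp add: f_def summable_sums)
  qed
  have f0: "f y = 0" if "y \<ge> 0" for y
    using sums [OF that] by (simp add: f_def sums_iff)
  show ?thesis
  proof (rule ccontr)
    assume "c n \<noteq> 0"
    \<comment> \<open>A nonzero coefficient of positive index makes the zero of f at 0 isolated,
      while f vanishes on the whole half-line. Index 0 was settled separately by evaluating at
      0.\<close>
    with False obtain s where "s > 0" "\<And>z. z \<in> cball 0 s - {0} \<Longrightarrow> f z \<noteq> 0"
      using powser_0_nonzero [OF zero_less_one f f0] by auto
    then show False
      using f0 [of s] by force
  qed
qed

lemma cosh_paired: "(\<lambda>n. x ^ (2 * n) / fact (2 * n)) sums cosh (x :: real)"
proof -
  have "strict_mono (\<lambda>n::nat. 2 * n)"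
    by (simp add: strict_mono_def)
  then have "(\<lambda>n. if even (2 * n) then x ^ (2 * n) /\<^sub>R fact (2 * n) else 0) sums cosh x"
    using cosh_converges [of x] by (subst sums_mono_reindex) (auto elim!: evenE)
  then show ?thesis
    by (simp add: divide_inverse mult.commute)
qed

text \<open>\<open>cosh\<close> averages the exponentials with slopes s and -s, whose Gaussian
  integrals agree because only the squared slope enters. Its series has only even powers, hence
  nonnegative terms, so it serves as a generating function that can be integrated termwise in
  \<open>ennreal\<close>.\<close>

lemma nn_integral_gaussian_cosh:
  fixes u :: "'a::euclidean_space"
  shows "(\<integral>\<^sup>+x. ennreal (cosh (s * (u \<bullet> x)) * exp (- (norm x)\<^sup>2)) \<partial>lborel)
    = ennreal (pi powr (real DIM('a) / 2) * exp (s\<^sup>2 * (norm u)\<^sup>2 / 4))"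
proof -
  let ?P = "pi powr (real DIM('a) / 2) * exp (s\<^sup>2 * (norm u)\<^sup>2 / 4)"
  have int: "(\<integral>\<^sup>+x. ennreal (exp ((c *\<^sub>R u) \<bullet> x - (norm x)\<^sup>2)) \<partial>lborel) = ennreal ?P"
    if "c\<^sup>2 = s\<^sup>2" for c
    unfolding nn_integral_gaussian_linear by (simp add: power_mult_distrib that)
  have "cosh (s * (u \<bullet> x)) * exp (- (norm x)\<^sup>2)
    = 1 / 2 * (exp ((s *\<^sub>R u) \<bullet> x - (norm x)\<^sup>2) + exp (((- s) *\<^sub>R u) \<bullet> x - (norm x)\<^sup>2))" for x :: 'a
    by (simp add: cosh_field_def exp_diff exp_minus field_simps)
  then have "(\<integral>\<^sup>+x. ennreal (cosh (s * (u \<bullet> x)) * exp (- (norm x)\<^sup>2)) \<partial>lborel)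
    = (\<integral>\<^sup>+x. ennreal (1 / 2) * (ennreal (exp ((s *\<^sub>R u) \<bullet> x - (norm x)\<^sup>2))
        + ennreal (exp (((- s) *\<^sub>R u) \<bullet> x - (norm x)\<^sup>2))) \<partial>lborel)"
    by (simp only: ennreal_mult' ennreal_plus exp_ge_zero)
  also have "\<dots> = ennreal (1 / 2) * (ennreal ?P + ennreal ?P)"
    by (subst nn_integral_cmult, measurable, subst nn_integral_add, measurable) (simp only: int power2_minus)
  also have "\<dots> = ennreal (1 / 2) * ennreal (?P + ?P)"
    by (subst ennreal_plus) auto
  also have "\<dots> = ennreal ?P"
    by (subst ennreal_mult' [symmetric]) auto
  finally show ?thesis .
qed

text \<open>The unit ball comes first: its moment times a Gamma value is a Gaussian moment, which is
  read off from the generating function. Homogeneity of degree 2m then gives radius R.\<close>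

lemma nn_integral_even_power_inner_ball:
  fixes u :: "'a::euclidean_space"
  assumes "R > 0"
  shows "(\<integral>\<^sup>+x\<in>ball 0 R. ennreal ((u \<bullet> x) ^ (2 * m)) \<partial>lborel)
    = ennreal (pi powr (real DIM('a) / 2) * R ^ DIM('a) * (fact (2 * m) / fact m)
        * (norm u * R / 2) ^ (2 * m) * rGamma (real m + real DIM('a) / 2 + 1))"
proof -
  define A where "A m = (\<integral>\<^sup>+x\<in>ball 0 1. ennreal ((u \<bullet> x) ^ (2 * m)) \<partial>lborel)" for m
  define a where "a m = enn2real (A m)" for m
  define G where "G m = Gamma (real m + real DIM('a) / 2 + 1)" for m
  define P where "P = pi powr (real DIM('a) / 2)"
  have G: "G m > 0" for m
    unfolding G_def by (intro Gamma_real_pos) (simp add: add_nonneg_pos)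
  have hom: "ennreal ((u \<bullet> (c *\<^sub>R x)) ^ (2 * m)) = ennreal (c ^ (2 * m)) * ennreal ((u \<bullet> x) ^ (2 * m))" for c x m
    by (simp add: power_mult_distrib flip: ennreal_mult')
  \<comment> \<open>Finiteness, by Cauchy-Schwarz on the unit ball, lets the real number
    \<open>a m\<close> represent the moment, so that coefficients can be compared and
    subtracted.\<close>
  have "A m \<noteq> \<infinity>" for m
  proof -
    have "A m \<le> (\<integral>\<^sup>+x. ennreal (norm u ^ (2 * m)) * indicator (ball 0 1) x \<partial>(lborel :: 'a measure))"
      unfolding A_def
    proof (intro nn_integral_mono)
      fix x :: 'a
      show "ennreal ((u \<bullet> x) ^ (2 * m)) * indicator (ball 0 1) x
        \<le> ennreal (norm u ^ (2 * m)) * indicator (ball 0 1) x"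
      proof (cases "x \<in> ball 0 1")
        case True
        then have "\<bar>u \<bullet> x\<bar> \<le> norm u"
          using Cauchy_Schwarz_ineq2 [of u x] mult_left_mono [of "norm x" 1 "norm u"] by auto
        then have "\<bar>u \<bullet> x\<bar> ^ (2 * m) \<le> norm u ^ (2 * m)"
          by (intro power_mono) auto
        then show ?thesis
          using True by (simp add: power_even_abs ennreal_leI)
      qed simp
    qed
    also have "\<dots> = ennreal (norm u ^ (2 * m)) * emeasure lborel (ball (0 :: 'a) 1)"
      by (rule nn_integral_cmult_indicator) simp
    also have "\<dots> < \<infinity>"
      using emeasure_bounded_finite [OF bounded_ball [of "0 :: 'a" 1]] by (simp add: ennreal_mult_less_top)
    finally show ?thesis by simp
  qed
  then have A: "A m = ennreal (a m)" for m
    by (simp add: a_def less_top)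
  have a_nonneg: "a m \<ge> 0" for m
    by (simp add: a_def)
  have gauss: "(\<integral>\<^sup>+x. ennreal ((u \<bullet> x) ^ (2 * m)) * ennreal (exp (- (norm x)\<^sup>2)) \<partial>lborel) = ennreal (G m * a m)" for m
  proof -
    have "G m = Gamma (real (DIM('a) + 2 * m) / 2 + 1)"
      by (simp add: G_def field_simps)
    then show ?thesis
      using nn_integral_homogeneous_gaussian [OF _ hom] G [of m]
      by (simp add: A_def [symmetric] A ennreal_mult')
  qed
  \<comment> \<open>The \<open>cosh\<close> integral is a power series in y = s^2 in two ways: by
    termwise integration, and by expanding \<open>exp (y * (norm u)\<^sup>2 / 4)\<close>. Their
    difference sums to 0 for every y >= 0.\<close>
  have coeff: "G m * a m / fact (2 * m) - P * ((norm u)\<^sup>2 / 4) ^ m / fact m = 0" for m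
  proof (rule powser_sums_0_imp_coeff_0)
    fix y :: real
    assume y: "y \<ge> 0"
    define s where "s = sqrt y"
    have s: "s ^ (2 * m) = y ^ m" for m
      using y by (simp add: s_def power_mult)
    have s': "s ^ (m * 2) = y ^ m" for m
      using s [of m] by (simp add: mult.commute)
    have "ennreal (cosh (s * (u \<bullet> x)) * exp (- (norm x)\<^sup>2))
      = (\<Sum>m. ennreal (y ^ m / fact (2 * m)) * (ennreal ((u \<bullet> x) ^ (2 * m)) * ennreal (exp (- (norm x)\<^sup>2))))" for x
    proof -
      have "(\<lambda>m. y ^ m / fact (2 * m) * ((u \<bullet> x) ^ (2 * m) * exp (- (norm x)\<^sup>2)))
        sums (cosh (s * (u \<bullet> x)) * exp (- (norm x)\<^sup>2))"
        using sums_mult2 [OF cosh_paired [of "s * (u \<bullet> x)"], of "exp (- (norm x)\<^sup>2)"]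
        by (simp add: power_mult_distrib s' mult_ac)
      then have "(\<lambda>m. ennreal (y ^ m / fact (2 * m) * ((u \<bullet> x) ^ (2 * m) * exp (- (norm x)\<^sup>2))))
        sums ennreal (cosh (s * (u \<bullet> x)) * exp (- (norm x)\<^sup>2))"
        using y by (subst sums_ennreal) auto
      moreover have "ennreal (y ^ m / fact (2 * m) * ((u \<bullet> x) ^ (2 * m) * exp (- (norm x)\<^sup>2)))
        = ennreal (y ^ m / fact (2 * m)) * (ennreal ((u \<bullet> x) ^ (2 * m)) * ennreal (exp (- (norm x)\<^sup>2)))" for m
        using y by (subst ennreal_mult', simp, subst ennreal_mult', simp_all)
      ultimately show ?thesis
        by (simp only: sums_iff)
    qed
    then have "ennreal (P * exp (y * (norm u)\<^sup>2 / 4))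
      = (\<integral>\<^sup>+x. (\<Sum>m. ennreal (y ^ m / fact (2 * m)) * (ennreal ((u \<bullet> x) ^ (2 * m)) * ennreal (exp (- (norm x)\<^sup>2)))) \<partial>lborel)"
      using nn_integral_gaussian_cosh [of s u] y by (simp add: P_def s_def)
    also have "\<dots> = (\<Sum>m. ennreal (y ^ m / fact (2 * m)) * ennreal (G m * a m))"
      by (simp add: nn_integral_suminf nn_integral_cmult gauss)
    also have "\<dots> = (\<Sum>m. ennreal (y ^ m / fact (2 * m) * (G m * a m)))"
      using y by (intro suminf_cong ennreal_mult' [symmetric]) simp
    finally have "(\<lambda>m. ennreal (y ^ m / fact (2 * m) * (G m * a m))) sums ennreal (P * exp (y * (norm u)\<^sup>2 / 4))"
      by (simp add: summable_sums summableI)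
    \<comment> \<open>Returning from \<open>ennreal\<close> to the reals uses that every term is
      nonnegative, hence the signs of \<open>G m\<close> and \<open>a m\<close>.\<close>
    then have "(\<lambda>m. y ^ m / fact (2 * m) * (G m * a m)) sums (P * exp (y * (norm u)\<^sup>2 / 4))"
      using y a_nonneg order.strict_implies_order [OF G] by (subst (asm) sums_ennreal) (simp_all add: P_def)
    moreover have "(\<lambda>m. P * ((y * (norm u)\<^sup>2 / 4) ^ m / fact m)) sums (P * exp (y * (norm u)\<^sup>2 / 4))"
      by (rule sums_mult) (use exp_converges [of "y * (norm u)\<^sup>2 / 4"] in \<open>simp only: real_scaleR_def divide_inverse_commute\<close>)
    ultimately have "(\<lambda>m. y ^ m / fact (2 * m) * (G m * a m) - P * ((y * (norm u)\<^sup>2 / 4) ^ m / fact m)) sums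
      (P * exp (y * (norm u)\<^sup>2 / 4) - P * exp (y * (norm u)\<^sup>2 / 4))"
      by (rule sums_diff)
    moreover have "y ^ m / fact (2 * m) * (G m * a m) - P * ((y * (norm u)\<^sup>2 / 4) ^ m / fact m)
      = (G m * a m / fact (2 * m) - P * ((norm u)\<^sup>2 / 4) ^ m / fact m) * y ^ m" for m
      by (simp add: power_mult_distrib power_divide algebra_simps)
    ultimately show "(\<lambda>m. (G m * a m / fact (2 * m) - P * ((norm u)\<^sup>2 / 4) ^ m / fact m) * y ^ m) sums 0"
      by simp
  qed
  have "(\<integral>\<^sup>+x\<in>ball 0 R. ennreal ((u \<bullet> x) ^ (2 * m)) \<partial>lborel) = ennreal (R ^ (DIM('a) + 2 * m)) * A m"
    using nn_integral_homogeneous_ball [OF _ hom assms] by (simp add: A_def)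
  also have "\<dots> = ennreal (R ^ (DIM('a) + 2 * m) * a m)"
    using assms by (simp add: A ennreal_mult')
  also have "R ^ (DIM('a) + 2 * m) * a m = P * R ^ DIM('a) * (fact (2 * m) / fact m) * (norm u * R / 2) ^ (2 * m) * inverse (G m)"
  proof -
    have "(norm u * R / 2) ^ (2 * m) = R ^ (2 * m) * ((norm u)\<^sup>2 / 4) ^ m"
      by (simp add: power_mult power_mult_distrib power_divide)
    moreover have "a m = P * ((norm u)\<^sup>2 / 4) ^ m * (fact (2 * m) / fact m) * inverse (G m)"
      using coeff [of m] G [of m] by (simp add: field_simps)
    ultimately show ?thesis
      by (simp only: power_add mult_ac)
  qed
  finally show ?thesis
    by (simp add: P_def G_def rGamma_inverse_Gamma)
qed

section \<open>The Fourier transform of a ball as a Bessel series\<close>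

lemma has_bochner_integral_even_power_inner_ball:
  fixes u :: "'a::euclidean_space"
  assumes "R > 0"
  shows "has_bochner_integral lborel (\<lambda>x. indicator (ball 0 R) x * (u \<bullet> x) ^ (2 * m))
    (pi powr (real DIM('a) / 2) * R ^ DIM('a) * (fact (2 * m) / fact m)
        * (norm u * R / 2) ^ (2 * m) * rGamma (real m + real DIM('a) / 2 + 1))"
proof (rule has_bochner_integral_nn_integral)
  have [measurable]: "ball (0 :: 'a) R \<in> sets borel"
    by simp
  show "(\<lambda>x. indicator (ball 0 R) x * (u \<bullet> x) ^ (2 * m)) \<in> borel_measurable lborel"
    by measurable
  have "rGamma (real m + real DIM('a) / 2 + 1) \<ge> 0"
    unfolding rGamma_inverse_Gamma
    by (intro inverse_nonnegative_iff_nonnegative [THEN iffD2] less_imp_le Gamma_real_pos) (simp add: add_nonneg_pos)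
  then show "0 \<le> pi powr (real DIM('a) / 2) * R ^ DIM('a) * (fact (2 * m) / fact m)
        * (norm u * R / 2) ^ (2 * m) * rGamma (real m + real DIM('a) / 2 + 1)"
    using assms by simp
  show "(\<integral>\<^sup>+x. ennreal (indicator (ball 0 R) x * (u \<bullet> x) ^ (2 * m)) \<partial>lborel)
    = ennreal (pi powr (real DIM('a) / 2) * R ^ DIM('a) * (fact (2 * m) / fact m)
        * (norm u * R / 2) ^ (2 * m) * rGamma (real m + real DIM('a) / 2 + 1))"
    unfolding nn_integral_even_power_inner_ball [OF assms, symmetric]
    by (intro nn_integral_cong) (simp add: indicator_def)
qed simp

text \<open>Integrate the cosine series termwise: its 1 / (2m)! cancels the (2m)! in the moment of
  order 2m, leaving the coefficients of the Bessel series.\<close>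

lemma integral_cos_inner_ball:
  fixes u :: "'a::euclidean_space"
  assumes "R > 0"
  shows "(LINT x|lborel. indicator (ball 0 R) x * cos (u \<bullet> x))
    = pi powr (real DIM('a) / 2) * R ^ DIM('a)
      * (\<Sum>m. (- 1) ^ m * rGamma (real m + real DIM('a) / 2 + 1) / fact m * (norm u * R / 2) ^ (2 * m))"
proof -
  define B where "B m = (- 1) ^ m * rGamma (real m + real DIM('a) / 2 + 1) / fact m * (norm u * R / 2) ^ (2 * m)" for m
  define K where "K = pi powr (real DIM('a) / 2) * R ^ DIM('a)"
  define f where "f m x = (- 1) ^ m / fact (2 * m) * (indicator (ball 0 R) x * (u \<bullet> x) ^ (2 * m))" for m x
  \<comment> \<open>On the ball Cauchy-Schwarz bounds |u . x| by \<open>norm u * R\<close>, so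
    \<open>C\<close> dominates the cosine terms. It is the series of
    \<open>cosh (norm u * R)\<close>, hence summable, which justifies the interchange.\<close>
  define C where "C m = (norm u * R) ^ (2 * m) / fact (2 * m)" for m
  have K: "K > 0"
    using assms by (simp add: K_def)
  have f: "has_bochner_integral lborel (f m) (K * B m)" for m
    using has_bochner_integral_mult_right [OF has_bochner_integral_even_power_inner_ball [OF assms, of u m], of "(- 1) ^ m / fact (2 * m)"]
    unfolding f_def [abs_def] by (simp add: K_def B_def field_simps)
  have sums_f: "(\<lambda>m. f m x) sums (indicator (ball 0 R) x * cos (u \<bullet> x))" for x
    using sums_mult [OF cos_paired [of "u \<bullet> x"], of "indicator (ball 0 R) x"]
    by (simp add: f_def mult_ac)
  have C: "summable C"
    unfolding C_def using cosh_paired by (rule sums_summable)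
  have f_le: "norm (f m x) \<le> C m * indicator (ball 0 R) x" for m x
  proof (cases "x \<in> ball 0 R")
    case True
    then have "\<bar>u \<bullet> x\<bar> \<le> norm u * R"
      using Cauchy_Schwarz_ineq2 [of u x] mult_left_mono [of "norm x" R "norm u"] by auto
    then have "\<bar>u \<bullet> x\<bar> ^ (2 * m) \<le> (norm u * R) ^ (2 * m)"
      by (intro power_mono) auto
    with True show ?thesis
      by (simp add: f_def C_def abs_mult power_abs divide_right_mono)
  qed (simp add: f_def)
  have ball: "integrable lborel (indicator (ball (0 :: 'a) R) :: 'a \<Rightarrow> real)"
    using emeasure_bounded_finite [OF bounded_ball [of "0 :: 'a" R]] by (intro integrable_real_indicator) auto
  have "(\<lambda>m. integral\<^sup>L lborel (f m)) sums (LINT x|lborel. (\<Sum>m. f m x))"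
  proof (rule sums_integral)
    show "integrable lborel (f m)" for m
      using f by (auto simp: has_bochner_integral_iff)
    have "summable (\<lambda>m. norm (f m x))" for x
      by (rule summable_comparison_test' [OF summable_mult2 [OF C, of "indicator (ball 0 R) x"], of 0])
        (use f_le in simp)
    then show "AE x in lborel. summable (\<lambda>m. norm (f m x))"
      by simp
    have "(LINT x|lborel. norm (f m x)) \<le> (LINT x|lborel. C m * indicator (ball 0 R) (x :: 'a))" for m
      by (rule integral_mono) (use f ball f_le in \<open>auto simp: has_bochner_integral_iff\<close>)
    then show "summable (\<lambda>m. LINT x|lborel. norm (f m x))"
      by (intro summable_comparison_test' [OF summable_mult2 [OF C, of "measure lborel (ball (0 :: 'a) R)"], of 0])
        simp
  qed
  then have "(\<lambda>m. K * B m) sums (LINT x|lborel. indicator (ball 0 R) x * cos (u \<bullet> x))"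
    using f sums_f by (simp add: has_bochner_integral_iff sums_iff)
  \<comment> \<open>As K is nonzero, summability passes from \<open>K * B m\<close> to
    \<open>B\<close>; this permits pulling K out of the sum.\<close>
  moreover from this have "summable B"
    using summable_mult_D [of K B] K by (auto simp: sums_iff)
  ultimately have "(LINT x|lborel. indicator (ball 0 R) x * cos (u \<bullet> x)) = K * (\<Sum>m. B m)"
    by (simp add: sums_iff suminf_mult)
  then show ?thesis
    by (simp only: K_def B_def)
qed

text \<open>Reflection preserves \<open>lborel\<close>, so the integral equals its own negative. If
  \<open>f\<close> is not integrable, the integral is 0 by the default value. This removes the
  imaginary part of the transform.\<close>

lemma integral_odd_lborel:
  fixes f :: "'a::euclidean_space \<Rightarrow> real"
  assumes [measurable]: "f \<in> borel_measurable borel" and odd: "\<And>x. f (- x) = - f x"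
  shows "(LINT x|lborel. f x) = 0"
proof -
  have "(lborel :: 'a measure) = distr lborel borel uminus"
    using lborel_affine [of "- 1" "0 :: 'a"] by (simp add: density_1 one_ennreal_def [symmetric])
  then have "(LINT x|lborel. f x) = (LINT x|distr lborel borel uminus. f x)"
    by simp
  also have "\<dots> = - (LINT x|lborel. f x)"
    by (subst integral_distr) (auto simp: odd)
  finally show ?thesis by simp
qed

section \<open>Power spectral density of the step design\<close>

theorem proposition8:
  fixes N :: nat and D :: "(real ^ 'd) set" and V r_min k :: real and kv :: "real ^ 'd"
  assumes "D \<in> lmeasurable" and "V = measure lebesgue D" and "V > 0"
    and "r_min > 0"
    and "k > 0" and "norm kv = k"
  shows "psd N V (step_pcf r_min) kv =
    complex_of_real
      (1 - real N / V * (2 * pi * r_min / k) powr (real CARD('d) / 2)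
             * Bessel_J (real CARD('d) / 2) (k * r_min))"
proof -
  let ?I = "indicator (ball 0 r_min) :: real ^ 'd \<Rightarrow> real"
  define F where "F x = complex_of_real (step_pcf r_min (norm x) - 1) * exp (- \<i> * complex_of_real (kv \<bullet> x))" for x
  have [measurable]: "ball (0 :: real ^ 'd) r_min \<in> sets borel"
    by simp
  have ball: "integrable lborel ?I"
    using emeasure_bounded_finite [OF bounded_ball [of "0 :: real ^ 'd" r_min]]
    by (intro integrable_real_indicator) auto
  have int: "integrable lborel (\<lambda>x. ?I x * cos (kv \<bullet> x))" "integrable lborel (\<lambda>x. ?I x * sin (kv \<bullet> x))"
    by (rule Bochner_Integration.integrable_bound [OF ball]; auto simp: indicator_def)+
  \<comment> \<open>The step function minus 1 is -1 on the open ball and 0 outside, so the integrand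
    is minus the Fourier kernel on the ball; this is the minus sign in the result.\<close>
  have F: "F x = \<i> * complex_of_real (?I x * sin (kv \<bullet> x)) - complex_of_real (?I x * cos (kv \<bullet> x))" for x
    unfolding F_def step_pcf_def exp_Euler
    by (simp add: exp_minus_Euler indicator_def sin_of_real cos_of_real)
  \<comment> \<open>The second factor is the power \<open>(x / 2) powr \<nu>\<close> in
    \<open>Bessel_J\<close> at x = k r_min. The bases multiply to pi r_min^2, which yields the
    prefactor of the ball transform.\<close>
  have powr: "(2 * pi * r_min / k) powr (real CARD('d) / 2) * (k * r_min / 2) powr (real CARD('d) / 2)
    = pi powr (real CARD('d) / 2) * r_min ^ CARD('d)"
  proof -
    have "(2 * pi * r_min / k) * (k * r_min / 2) = pi * r_min\<^sup>2"
      using assms by (simp add: power2_eq_square)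
    moreover have "(r_min\<^sup>2) powr (real CARD('d) / 2) = r_min ^ CARD('d)"
    proof -
      have "(r_min\<^sup>2) powr (real CARD('d) / 2) = (r_min powr 2) powr (real CARD('d) / 2)"
        using assms by simp
      also have "\<dots> = r_min powr real CARD('d)"
        by (simp only: powr_powr) simp
      finally show ?thesis
        using assms by (simp add: powr_realpow)
    qed
    ultimately have "((2 * pi * r_min / k) * (k * r_min / 2)) powr (real CARD('d) / 2)
      = pi powr (real CARD('d) / 2) * r_min ^ CARD('d)"
      by (simp add: powr_mult)
    then show ?thesis
      by (simp only: powr_mult)
  qed
  \<comment> \<open>The integrand is Borel measurable, so completing the measure does not change its
    integral.\<close>
  have "integral\<^sup>L lebesgue F = integral\<^sup>L lborel F"
    by (rule integral_completion) (simp add: F [abs_def])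
  also have "\<dots> = \<i> * complex_of_real (LINT x|lborel. ?I x * sin (kv \<bullet> x))
      - complex_of_real (LINT x|lborel. ?I x * cos (kv \<bullet> x))"
    unfolding F using int by (subst Bochner_Integration.integral_diff)
      (auto simp del: of_real_mult)
  also have "(LINT x|lborel. ?I x * sin (kv \<bullet> x)) = 0"
    by (rule integral_odd_lborel) (auto simp: indicator_def)
  also have "(LINT x|lborel. ?I x * cos (kv \<bullet> x))
    = (2 * pi * r_min / k) powr (real CARD('d) / 2) * Bessel_J (real CARD('d) / 2) (k * r_min)"
    unfolding integral_cos_inner_ball [OF \<open>r_min > 0\<close>] Bessel_J_def
    using powr by (simp add: assms(6) mult.assoc [symmetric])
  finally show ?thesis
    unfolding psd_def F_def by simp
qed

end
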